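(* Let $K\in\mathbb{R}^{p\times d}$, $A\in\mathbb{R}^{q\times d}$, $B\in\mathbb{R}^{r\times d}$ be real matrices, $y\in\mathbb{R}^p$, $b\in\mathbb{R}^r$, $\lambda>0$ and $\alpha\in\mathbb{R}$. Suppose that the set $\{x\in\mathbb{R}^d : Bx=b\}$ is non-empty, $\|AA^T\|<1$, $\|\tfrac12 K^TK+B^TB\|<1$ and $\alpha>\tfrac12$. Let $(x^0,w^0,v^0)\in\mathbb{R}^d\times\mathbb{R}^q\times\mathbb{R}^r$ be arbitrary and define the sequence $(x^n,w^n,v^n)_{n\in\mathbb{N}}$ by the iteration $$ \left\{ \begin{array}{lcl} \bar v^{n+1}&=&v^n-(Bx^n-b)\\ \bar x^{n+1}&=&x^n+K^T(y-Kx^n)+B^T\bar v^{n+1}-A^Tw^n\\ w^{n+1}&=&\mathbb{P}_{\lambda}(w^n+A\bar x^{n+1})\\ x^{n+1}&=&x^n+K^T(y-Kx^n)+B^T \bar v^{n+1}-A^Tw^{n+1}\\ v^{n+1}&=&v^n-\frac{1}{\alpha}(Bx^{n+1}-b). \end{array}\right. $$ Then $(x^n,w^n,v^n)$ converges, as $n\to\infty$, to some $(x^\dagger,w^\dagger,v^\dagger)$ that satisfies the variational equations $$K^T(Kx^\dagger-y)+A^Tw^\dagger-B^Tv^\dagger=0,\qquad w^\dagger=\mathbb{P}_\lambda(w^\dagger+Ax^\dagger),\qquad Bx^\dagger=b,$$ and $x^\dagger$ is a solution of the minimization problem $$\min_{x\in\mathbb{R}^d,\ Bx=b}\ \|Kx-y\|^2+2\lambda\|Ax\|_1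 .$$
   Context: All spaces are finite-dimensional real Euclidean spaces; $\|\cdot\|$ is the Euclidean norm on vectors and the induced operator (spectral) norm on matrices, and $\|u\|_1=\sum_i|u_i|$. For $z\in\mathbb{R}$, $P_\lambda(z)=z$ if $|z|\le\lambda$ and $P_\lambda(z)=\lambda z/|z|$ if $|z|>\lambda$; $\mathbb{P}_\lambda(u)$ denotes the application of $P_\lambda$ to each component of the vector $u$, i.e. the projection onto the $\ell_\infty$-ball of radius $\lambda$. *)

theory Defs
  imports "HOL-Analysis.Analysis"
begin

definition clip :: "real \<Rightarrow> real \<Rightarrow> real" where
  "clip l z = (if \<bar>z\<bar> \<le> l then z else l * z / \<bar>z\<bar>)"

definition clip_vec :: "real \<Rightarrow> real ^ 'n \<Rightarrow> real ^ 'n" where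
  "clip_vec l u = (\<chi> i. clip l (u $ i))"

(* The library norm on real ^ 'n is the Euclidean one. *)
definition l1_norm :: "real ^ 'n \<Rightarrow> real" where
  "l1_norm u = (\<Sum>i\<in>UNIV. \<bar>u $ i\<bar>)"

(* The library norm on real ^ 'n ^ 'm is the Frobenius norm; the spectral norm is
   the operator norm of the associated linear map between Euclidean spaces. *)
definition spectral_norm :: "real ^ 'n ^ 'm \<Rightarrow> real" where
  "spectral_norm M = onorm (\<lambda>x. M *v x)"

end

theory Submission
  imports Defs
begin

text \<open>Call the solutions of the variational equations KKT triples. Relative to a KKT triple, the energy
  \<open>\<parallel>x\<parallel>\<^sup>2 - \<parallel>B x\<parallel>\<^sup>2 + \<parallel>w\<parallel>\<^sup>2 - \<parallel>A\<^sup>T w\<parallel>\<^sup>2 + \<alpha> \<parallel>v\<parallel>\<^sup>2\<close> is positive definite and drops in each step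
  by at least a multiple of \<open>\<parallel>\<Delta>x\<parallel>\<^sup>2 + \<parallel>\<Delta>w\<parallel>\<^sup>2 + (2 - 1/\<alpha>) \<parallel>B x - b\<parallel>\<^sup>2\<close>. Hence the iterates are
  bounded and every cluster point is again a KKT triple; measuring the energy relative to a cluster
  point turns subsequential convergence into convergence. A KKT triple exists because the objective
  attains its minimum on the constraint set and a separation argument yields the multipliers.\<close>

section \<open>Clipping: projection onto a box and subgradients of the scaled absolute value\<close>

lemma clip_eq_max_min: "l > 0 \<Longrightarrow> clip l z = max (- l) (min l z)"
  by (auto simp: clip_def max_def min_def abs_if field_simps)

text \<open>Obtuse-angle property of the projection onto the interval \<open>[-l, l]\<close>: for
  \<open>z\<close> outside it, \<open>clip l z\<close> is the endpoint nearest to \<open>z\<close>,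
  so the two factors cannot have opposite signs; for \<open>z\<close> inside, the second factor is
  zero.\<close>

lemma clip_projection:
  assumes "l > 0" "\<bar>s\<bar> \<le> l"
  shows "0 \<le> (clip l z - s) * (z - clip l z)"
proof -
  consider "z < - l" | "\<bar>z\<bar> \<le> l" | "z > l" by linarith
  then show ?thesis
  proof cases
    case 1
    then show ?thesis using assms
      by (intro mult_nonpos_nonpos) (auto simp: clip_eq_max_min)
  next
    case 2
    then show ?thesis by (simp add: clip_def)
  next
    case 3
    then show ?thesis using assms
      by (intro mult_nonneg_nonneg) (auto simp: clip_eq_max_min)
  qed
qed

text \<open>Translates the fixed-point equation into convex analysis: the right-hand side says that
  \<open>w\<close> is a subgradient of \<open>l * \<bar>_\<bar>\<close> at \<open>a\<close>.\<close>

lemma clip_fixed_iff: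
  assumes "l > 0"
  shows "w = clip l (w + a) \<longleftrightarrow> \<bar>w\<bar> \<le> l \<and> w * a = l * \<bar>a\<bar>"
proof -
  have neg: "w * a = - (l * a) \<longleftrightarrow> w = - l" if "a < 0"
    using that mult_cancel_right[of w a "- l"] by auto
  consider "a < 0" | "a = 0" | "a > 0" by linarith
  then show ?thesis
    using assms by cases (auto simp: clip_eq_max_min max_def min_def neg)
qed

lemma tendsto_clip_vec:
  assumes "l > 0" "(f \<longlongrightarrow> a) F"
  shows "((\<lambda>n. clip_vec l (f n)) \<longlongrightarrow> clip_vec l a) F"
  unfolding clip_vec_def clip_eq_max_min[OF assms(1)]
  by (intro vec_tendstoI) (auto intro!: tendsto_intros assms(2))

lemma clip_vec_projection:
  assumes "l > 0" "\<And>i. \<bar>s $ i\<bar> \<le> l"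
  shows "0 \<le> (clip_vec l u - s) \<bullet> (u - clip_vec l u)"
  unfolding inner_vec_def clip_vec_def
  by (auto intro!: sum_nonneg clip_projection assms)

lemma clip_vec_fixed_iff:
  assumes "l > 0"
  shows "w = clip_vec l (w + a) \<longleftrightarrow> (\<forall>i. \<bar>w $ i\<bar> \<le> l \<and> w $ i * a $ i = l * \<bar>a $ i\<bar>)"
  unfolding clip_vec_def vec_eq_iff by (simp add: clip_fixed_iff[OF assms])

section \<open>Adjoint identities and the quadratic form bound by the spectral norm\<close>

declare transpose_matrix_vector [simp del]

text \<open>Adjointness. The default rewriting of \<open>transpose M *v w\<close> into
  \<open>w v* M\<close> is switched off above so that this can serve as a rewrite rule.\<close>

lemma inner_transpose_mult: "u \<bullet> (transpose M *v w) = (M *v u) \<bullet> w"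
  for M :: "real ^ 'n ^ 'm"
  using dot_lmul_matrix[of w M u] by (simp add: transpose_matrix_vector inner_commute)

lemma inner_mult_eq_transpose: "w \<bullet> (M *v u) = (transpose M *v w) \<bullet> u"
  for M :: "real ^ 'n ^ 'm"
  using inner_transpose_mult[of u M w] by (simp add: inner_commute)

lemmas tendsto_matrix_vector_mult [tendsto_intros] =
  bounded_linear.tendsto [OF matrix_vector_mul_bounded_linear]

lemma inner_le_spectral_norm:
  fixes M :: "real ^ 'n ^ 'n"
  shows "u \<bullet> (M *v u) \<le> spectral_norm M * (norm u)\<^sup>2"
proof -
  have "u \<bullet> (M *v u) \<le> norm u * norm (M *v u)" by (rule norm_cauchy_schwarz)
  also have "\<dots> \<le> norm u * (spectral_norm M * norm u)"
    unfolding spectral_norm_def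
    by (intro mult_left_mono onorm matrix_vector_mul_bounded_linear norm_ge_zero)
  finally show ?thesis by (simp add: power2_eq_square mult_ac)
qed

section \<open>KKT triples and minimisers of the constrained problem\<close>

definition kkt ::
  "real ^ 'd ^ 'p \<Rightarrow> real ^ 'd ^ 'q \<Rightarrow> real ^ 'd ^ 'r \<Rightarrow> real ^ 'p \<Rightarrow> real ^ 'r \<Rightarrow> real
    \<Rightarrow> real ^ 'd \<Rightarrow> real ^ 'q \<Rightarrow> real ^ 'r \<Rightarrow> bool" where
  "kkt K A B y b l x w v \<longleftrightarrow>
     transpose K *v (K *v x - y) + transpose A *v w - transpose B *v v = 0 \<and>
     w = clip_vec l (w + A *v x) \<and> B *v x = b"

text \<open>Convexity: \<open>w \<bullet> u \<le> l * l1_norm u\<close> for all \<open>u\<close>,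
  with equality at \<open>u = A *v x\<close>. Expanding the square around \<open>x\<close> leaves a
  cross term that stationarity expresses through \<open>w\<close> and \<open>v\<close>; the
  \<open>v\<close> part vanishes because \<open>z - x\<close> lies in the kernel of
  \<open>B\<close>.\<close>

lemma kkt_imp_arg_min:
  fixes K :: "real ^ 'd ^ 'p" and A :: "real ^ 'd ^ 'q" and B :: "real ^ 'd ^ 'r"
  assumes "l > 0" and kkt: "kkt K A B y b l x w v"
  shows "is_arg_min (\<lambda>z. (norm (K *v z - y))\<^sup>2 + 2 * l * l1_norm (A *v z)) (\<lambda>z. B *v z = b) x"
proof -
  have stat: "transpose K *v (K *v x - y) = transpose B *v v - transpose A *v w"
    and Bx: "B *v x = b"
    and w: "\<And>i. \<bar>w $ i\<bar> \<le> l" "\<And>i. w $ i * (A *v x) $ i = l * \<bar>(A *v x) $ i\<bar>"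
    using kkt assms(1) by (auto simp: kkt_def clip_vec_fixed_iff algebra_simps)
  have wx: "w \<bullet> (A *v x) = l * l1_norm (A *v x)"
    by (simp add: inner_vec_def l1_norm_def w(2) sum_distrib_left)
  have wz: "w \<bullet> u \<le> l * l1_norm u" for u
    unfolding inner_vec_def l1_norm_def sum_distrib_left
  proof (rule sum_mono)
    fix i
    have "w $ i * u $ i \<le> \<bar>w $ i\<bar> * \<bar>u $ i\<bar>" by (metis abs_ge_self abs_mult)
    also have "\<dots> \<le> l * \<bar>u $ i\<bar>" by (intro mult_right_mono w(1)) simp
    finally show "w $ i \<bullet> u $ i \<le> l * \<bar>u $ i\<bar>" by simp
  qed
  have "(norm (K *v x - y))\<^sup>2 + 2 * l * l1_norm (A *v x)
      \<le> (norm (K *v z - y))\<^sup>2 + 2 * l * l1_norm (A *v z)" if Bz: "B *v z = b" for z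
  proof -
    have "(K *v (z - x)) \<bullet> (K *v x - y) = (z - x) \<bullet> (transpose B *v v - transpose A *v w)"
      unfolding stat[symmetric] by (simp add: inner_transpose_mult)
    also have "\<dots> = w \<bullet> (A *v x) - w \<bullet> (A *v z)"
      by (simp add: inner_diff_right inner_transpose_mult Bx Bz matrix_vector_mult_diff_distrib
          inner_diff_left inner_commute)
    finally have "(K *v (z - x)) \<bullet> (K *v x - y) \<ge> l * l1_norm (A *v x) - l * l1_norm (A *v z)"
      using wx wz[of "A *v z"] by simp
    moreover have "(norm (K *v z - y))\<^sup>2
        = (norm (K *v x - y))\<^sup>2 + 2 * ((K *v (z - x)) \<bullet> (K *v x - y)) + (norm (K *v (z - x)))\<^sup>2"
      unfolding power2_norm_eq_inner matrix_vector_mult_diff_distrib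
      by (simp add: algebra_simps inner_commute)
    ultimately show ?thesis
      using zero_le_power2[of "norm (K *v (z - x))"] unfolding mult.assoc by linarith
  qed
  then show ?thesis by (simp add: is_arg_min_linorder Bx)
qed

text \<open>The pairs \<open>(K z, A z)\<close> with \<open>B z = b\<close> form a closed affine set, on which the objective is
  coercive even when it is not coercive in \<open>z\<close>.\<close>

lemma arg_min_exists:
  fixes K :: "real ^ 'd ^ 'p" and A :: "real ^ 'd ^ 'q" and B :: "real ^ 'd ^ 'r"
  assumes "l > 0" and "B *v z0 = b"
  shows "\<exists>x. is_arg_min (\<lambda>z. (norm (K *v z - y))\<^sup>2 + 2 * l * l1_norm (A *v z)) (\<lambda>z. B *v z = b) x"
proof -
  define F where "F p = (norm (fst p - y))\<^sup>2 + 2 * l * l1_norm (snd p)"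
    for p :: "(real ^ 'p) \<times> (real ^ 'q)"
  define T where "T z = (K *v z, A *v z)" for z
  define D where "D = T ` {z. B *v z = b} \<inter> {p. F p \<le> F (T z0)}"
  have cont: "continuous_on UNIV F"
    unfolding F_def l1_norm_def by (intro continuous_intros)
  have "linear T"
    unfolding T_def by (intro linearI) (simp_all add: matrix_vector_right_distrib matrix_vector_mult_scaleR)
  moreover have "affine {z. B *v z = b}"
    by (auto simp: affine_def matrix_vector_right_distrib matrix_vector_mult_scaleR
        simp flip: scaleR_left_distrib)
  \<comment> \<open>A linear image of an affine set is affine, hence its own affine hull, and affine
    hulls are closed in finite dimension.\<close>
  ultimately have "T ` {z. B *v z = b} = affine hull (T ` {z. B *v z = b})"
    by (metis affine_hull_linear_image hull_same linear_conv_bounded_linear)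
  then have "closed (T ` {z. B *v z = b})"
    by (metis closed_affine_hull)
  then have "closed D"
    unfolding D_def using cont by (intro closed_Int closed_Collect_le continuous_on_const)
  moreover have "bounded D"
  proof -
    \<comment> \<open>Both summands of \<open>F\<close> are nonnegative, so on the sublevel set each
      is at most \<open>F (T z0)\<close>; the first controls \<open>fst p\<close>, the second
      \<open>snd p\<close>.\<close>
    have "norm p \<le> sqrt (F (T z0)) + norm y + F (T z0) / (2 * l)" if "p \<in> D" for p
    proof -
      have le: "F p \<le> F (T z0)" using that by (simp add: D_def)
      have l1: "norm (snd p) \<le> l1_norm (snd p)"
        unfolding l1_norm_def by (rule norm_le_l1_cart)
      then have nn: "0 \<le> l * l1_norm (snd p)"
        using assms(1) norm_ge_zero[of "snd p"] by (intro mult_nonneg_nonneg) linarith+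
      have "(norm (fst p - y))\<^sup>2 \<le> F (T z0)" using le nn by (simp add: F_def)
      then have a: "norm (fst p - y) \<le> sqrt (F (T z0))" by (rule real_le_rsqrt)
      have "2 * l * l1_norm (snd p) \<le> F (T z0)"
        using le zero_le_power2[of "norm (fst p - y)"] unfolding F_def by linarith
      then have b: "l1_norm (snd p) \<le> F (T z0) / (2 * l)"
        using assms(1) by (simp add: field_simps)
      have "norm p \<le> norm (fst p) + norm (snd p)"
        using norm_Pair_le[of "fst p" "snd p"] by simp
      moreover have "norm (fst p) \<le> norm (fst p - y) + norm y"
        by (metis diff_add_cancel norm_triangle_ineq)
      ultimately show ?thesis using a b l1 by linarith
    qed
    then show ?thesis unfolding bounded_iff by blast
  qed
  ultimately have "compact D" by (simp add: compact_eq_bounded_closed)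
  moreover have "T z0 \<in> D" using assms(2) by (auto simp: D_def)
  ultimately obtain p where p: "p \<in> D" "\<And>q. q \<in> D \<Longrightarrow> F p \<le> F q"
    using continuous_attains_inf[of D F] continuous_on_subset[OF cont] by blast
  then obtain x where x: "B *v x = b" "p = T x" by (auto simp: D_def)
  \<comment> \<open>Feasible points mapped outside \<open>D\<close> have values above
    \<open>F (T z0)\<close>, so a minimiser over \<open>D\<close> is a minimiser over the whole
    constraint set.\<close>
  have "F (T x) \<le> F (T z)" if "B *v z = b" for z
  proof (cases "F (T z) \<le> F (T z0)")
    case True
    then show ?thesis using p(2)[of "T z"] that x by (auto simp: D_def)
  next
    case False
    then show ?thesis using p(1) x by (auto simp: D_def)
  qed
  then have "is_arg_min (\<lambda>z. F (T z)) (\<lambda>z. B *v z = b) x"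
    using x by (simp add: is_arg_min_linorder)
  then show ?thesis by (auto simp: F_def T_def)
qed

section \<open>Directional derivatives of the l1 norm and existence of multipliers\<close>

text \<open>The absolute value is piecewise linear, so for small \<open>t > 0\<close> its
  first-order expansion along \<open>d\<close> is exact; the slope is realised by a subgradient
  \<open>w\<close>, chosen depending on \<open>d\<close>.\<close>

lemma abs_directional:
  fixes z d l :: real
  assumes "l > 0"
  obtains w where "\<bar>w\<bar> \<le> l" "w * z = l * \<bar>z\<bar>"
    "\<forall>\<^sub>F t in at_right 0. l * \<bar>z + t * d\<bar> = l * \<bar>z\<bar> + t * (w * d)"
proof -
  have lim: "((\<lambda>t. z + t * d) \<longlongrightarrow> z + 0 * d) (at_right 0)"
    by (intro tendsto_intros)
  consider "z < 0" | "z = 0" | "z > 0" by linarith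
  then show thesis
  proof cases
    case 1
    then have "\<forall>\<^sub>F t in at_right 0. z + t * d < 0"
      using order_tendstoD(2)[OF lim, of 0] by simp
    then show ?thesis using 1 assms
      by (intro that[of "- l"]) (auto elim!: eventually_mono simp: algebra_simps)
  next
    case 2
    have "\<forall>\<^sub>F t::real in at_right 0. 0 < t" by (rule eventually_at_right_less)
    then show ?thesis using 2 assms
      \<comment> \<open>At the kink every number in \<open>[-l, l]\<close> is a subgradient; this
        one maximises \<open>w * d\<close>.\<close>
      by (intro that[of "l * sgn d"])
        (auto elim!: eventually_mono simp: abs_mult sgn_if mult.left_commute)
  next
    case 3
    then have "\<forall>\<^sub>F t in at_right 0. z + t * d > 0"
      using order_tendstoD(1)[OF lim, of 0] by simp
    then show ?thesis using 3 assms
      by (intro that[of l]) (auto elim!: eventually_mono simp: algebra_simps)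
  qed
qed

text \<open>Coordinatewise use of the scalar case; as there are finitely many coordinates, a common
  range of small \<open>t\<close> exists.\<close>

lemma l1_norm_directional:
  fixes z d :: "real ^ 'n"
  assumes "l > 0"
  obtains w where "w = clip_vec l (w + z)"
    "\<forall>\<^sub>F t in at_right 0. l * l1_norm (z + t *\<^sub>R d) = l * l1_norm z + t * (w \<bullet> d)"
proof -
  define good where "good i c \<longleftrightarrow> \<bar>c\<bar> \<le> l \<and> c * z $ i = l * \<bar>z $ i\<bar> \<and>
    (\<forall>\<^sub>F t in at_right 0. l * \<bar>z $ i + t * d $ i\<bar> = l * \<bar>z $ i\<bar> + t * (c * d $ i))" for i c
  have "\<exists>c. good i c" for i
    using abs_directional[OF assms, of "z $ i" "d $ i"] unfolding good_def by blast
  then obtain w where "\<And>i. good i (w i)"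
    by metis
  then have w: "\<And>i. \<bar>w i\<bar> \<le> l" "\<And>i. w i * z $ i = l * \<bar>z $ i\<bar>"
    "\<And>i. \<forall>\<^sub>F t in at_right 0. l * \<bar>z $ i + t * d $ i\<bar> = l * \<bar>z $ i\<bar> + t * (w i * d $ i)"
    by (simp_all add: good_def)
  have "\<forall>\<^sub>F t in at_right 0. \<forall>i. l * \<bar>z $ i + t * d $ i\<bar> = l * \<bar>z $ i\<bar> + t * (w i * d $ i)"
    by (intro eventually_all_finite w(3))
  then have "\<forall>\<^sub>F t in at_right 0. l * l1_norm (z + t *\<^sub>R d) = l * l1_norm z + t * ((\<chi> i. w i) \<bullet> d)"
    by eventually_elim (simp add: l1_norm_def inner_vec_def sum_distrib_left sum.distrib)
  then show thesis
    using w by (intro that[of "\<chi> i. w i"]) (auto simp: clip_vec_fixed_iff[OF assms])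
qed

text \<open>Makes compactness and convexity of the subgradient set immediate: each coordinate ranges
  over a single endpoint, or over all of \<open>[-l, l]\<close> where \<open>z\<close>
  vanishes.\<close>

lemma clip_vec_fixed_set_eq_cbox:
  assumes "l > 0"
  shows "{w. w = clip_vec l (w + z)}
    = cbox (\<chi> i. if z $ i > 0 then l else - l) (\<chi> i. if z $ i < 0 then - l else l)"
proof -
  have "\<bar>w\<bar> \<le> l \<and> w * z = l * \<bar>z\<bar> \<longleftrightarrow>
    (if z > 0 then l else - l) \<le> w \<and> w \<le> (if z < 0 then - l else l)" for w z :: real
    using assms mult_cancel_right[of w z "- l"]
    by (cases z "0::real" rule: linorder_cases) auto
  then show ?thesis
    by (simp only: set_eq_iff mem_Collect_eq mem_box_cart clip_vec_fixed_iff[OF assms]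
        vec_lambda_beta simp_thms)
qed

text \<open>Without multipliers, \<open>K\<^sup>T (y - K x)\<close> could be strictly separated from the closed convex set
  of all \<open>A\<^sup>T w + B\<^sup>T u\<close> with \<open>w\<close> a subgradient at \<open>A x\<close>; the separating normal is then a feasible
  ascent direction, so its negative contradicts minimality.\<close>

lemma kkt_exists:
  fixes K :: "real ^ 'd ^ 'p" and A :: "real ^ 'd ^ 'q" and B :: "real ^ 'd ^ 'r"
  assumes l: "l > 0" and "B *v z0 = b"
  shows "\<exists>x w v. kkt K A B y b l x w v"
proof -
  obtain x where Bx: "B *v x = b"
    and min: "\<And>z. B *v z = b \<Longrightarrow>
      (norm (K *v x - y))\<^sup>2 + 2 * l * l1_norm (A *v x)
      \<le> (norm (K *v z - y))\<^sup>2 + 2 * l * l1_norm (A *v z)"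
    using arg_min_exists[OF assms, of K y A] by (auto simp: is_arg_min_linorder)
  define W where "W = {w. w = clip_vec l (w + A *v x)}"
  define S where "S = (\<Union>p \<in> (*v) (transpose A) ` W. \<Union>q \<in> range ((*v) (transpose B)). {p + q})"
  have W: "compact W" "convex W"
    by (simp_all add: W_def clip_vec_fixed_set_eq_cbox[OF l] compact_cbox convex_box)
  \<comment> \<open>Compactness of one summand matters here: the sum of two merely closed sets need
    not be closed.\<close>
  have "compact ((*v) (transpose A) ` W)"
    by (intro compact_continuous_image matrix_vector_mult_linear_continuous_on W)
  moreover have "closed (range ((*v) (transpose B)))"
    by (intro closed_subspace linear_subspace_image) auto
  ultimately have clS: "closed S" unfolding S_def by (rule compact_closed_sums)
  have cvS: "convex S" unfolding S_def
    by (intro convex_sums convex_linear_image W convex_UNIV) auto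
  have "transpose K *v (y - K *v x) \<in> S"
  proof (rule ccontr)
    assume "transpose K *v (y - K *v x) \<notin> S"
    then obtain a \<beta> where a: "a \<bullet> (transpose K *v (y - K *v x)) < \<beta>"
      "\<And>s. s \<in> S \<Longrightarrow> \<beta> < a \<bullet> s"
      using separating_hyperplane_closed_point[OF cvS clS] by blast
    have aS: "\<beta> < (A *v a) \<bullet> w + (B *v a) \<bullet> u" if "w \<in> W" for w u
      using a(2)[of "transpose A *v w + transpose B *v u"] that
      by (auto simp: S_def inner_add_right inner_transpose_mult)
    \<comment> \<open>Among the subgradients at \<open>A *v x\<close>, this one attains the
      directional derivative along \<open>- (A *v a)\<close>.\<close>
    obtain w where w: "w = clip_vec l (w + A *v x)"
      and ev: "\<forall>\<^sub>F t in at_right 0. l * l1_norm (A *v x + t *\<^sub>R (A *v (- a)))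
        = l * l1_norm (A *v x) + t * (w \<bullet> (A *v (- a)))"
      using l1_norm_directional[OF l] by blast
    then have wW: "w \<in> W" unfolding W_def by blast
    \<comment> \<open>Since \<open>u\<close> is free, a nonzero \<open>B *v a\<close> would allow a
      multiple of it, taken as \<open>u\<close>, to make the right-hand side of \<open>aS\<close>
      equal to \<open>\<beta>\<close>.\<close>
    have Ba: "B *v a = 0"
    proof (rule ccontr)
      assume "B *v a \<noteq> 0"
      then show False
        using aS[OF wW, of "((\<beta> - (A *v a) \<bullet> w) / ((B *v a) \<bullet> (B *v a))) *\<^sub>R (B *v a)"] by simp
    qed
    \<comment> \<open>The one-sided derivative of the objective at \<open>x\<close> along
      \<open>- a\<close>. Separation with \<open>u = 0\<close> makes it negative;
      \<open>t * (norm (K *v a))\<^sup>2\<close> below is the quadratic remainder divided by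
      \<open>t\<close>.\<close>
    define c where "c = 2 * ((K *v a) \<bullet> (y - K *v x)) - 2 * (w \<bullet> (A *v a))"
    have "c < 0"
      using a(1) aS[OF wW, of 0] by (simp add: c_def inner_transpose_mult inner_commute)
    moreover have "((\<lambda>t. c + t * (norm (K *v a))\<^sup>2) \<longlongrightarrow> c + 0 * (norm (K *v a))\<^sup>2) (at_right 0)"
      by (intro tendsto_intros)
    ultimately have "\<forall>\<^sub>F t in at_right 0. c + t * (norm (K *v a))\<^sup>2 < 0"
      using order_tendstoD(2)[of _ c "at_right (0::real)" 0] by simp
    moreover have "\<forall>\<^sub>F t::real in at_right 0. 0 < t" by (rule eventually_at_right_less)
    ultimately have "\<forall>\<^sub>F t::real in at_right 0. False"
      using ev
    proof eventually_elim
      case (elim t)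
      let ?z = "x + t *\<^sub>R (- a)"
      have "B *v ?z = b"
        using Ba Bx by (simp add: matrix_vector_mult_diff_distrib matrix_vector_mult_scaleR)
      from min[OF this] have m: "(norm (K *v x - y))\<^sup>2 + 2 * (l * l1_norm (A *v x))
          \<le> (norm (K *v ?z - y))\<^sup>2 + 2 * (l * l1_norm (A *v ?z))" by simp
      have "(norm (K *v ?z - y))\<^sup>2
          = (norm (K *v x - y))\<^sup>2 + t * (2 * ((K *v a) \<bullet> (y - K *v x))) + t * (t * (norm (K *v a))\<^sup>2)"
        unfolding power2_norm_eq_inner
        by (simp add: matrix_vector_mult_diff_distrib matrix_vector_mult_scaleR algebra_simps
            inner_commute)
      moreover have "l * l1_norm (A *v ?z) = l * l1_norm (A *v x) - t * (w \<bullet> (A *v a))"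
        using elim(3) by (simp add: matrix_vector_mult_diff_distrib matrix_vector_mult_scaleR
            mult.commute linear_neg[OF matrix_vector_mul_linear])
      ultimately have "0 \<le> t * (c + t * (norm (K *v a))\<^sup>2)"
        using m by (simp add: c_def algebra_simps)
      then show False using elim(1,2) by (simp add: zero_le_mult_iff)
    qed
    then show False by (simp add: trivial_limit_at_right_real)
  qed
  then obtain w u where "w \<in> W"
    "transpose K *v (y - K *v x) = transpose A *v w + transpose B *v u"
    by (auto simp: S_def)
  moreover from this(2) have
    "transpose K *v (K *v x - y) + transpose A *v w - transpose B *v (- u) = 0"
    by (simp add: matrix_vector_mult_diff_distrib algebra_simps linear_neg[OF matrix_vector_mul_linear])
  ultimately have "kkt K A B y b l x w (- u)"
    using Bx unfolding kkt_def W_def by blast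
  then show ?thesis by blast
qed

section \<open>The energy: coercivity and descent\<close>

text \<open>The quadratic form of the block diagonal matrix with blocks
  \<open>I - B\<^sup>T B\<close>, \<open>I - A A\<^sup>T\<close> and \<open>\<alpha> I\<close>, the
  metric in which the iteration is monotone.\<close>

definition energy ::
  "real ^ 'd ^ 'q \<Rightarrow> real ^ 'd ^ 'r \<Rightarrow> real \<Rightarrow> real ^ 'd \<Rightarrow> real ^ 'q \<Rightarrow> real ^ 'r \<Rightarrow> real" where
  "energy A B \<alpha> x w v = (norm x)\<^sup>2 - (norm (B *v x))\<^sup>2
     + (norm w)\<^sup>2 - (norm (transpose A *v w))\<^sup>2 + \<alpha> * (norm v)\<^sup>2"

lemma norm_transpose_le_spectral_norm:
  "(norm (transpose A *v w))\<^sup>2 \<le> spectral_norm (A ** transpose A) * (norm w)\<^sup>2"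
  using inner_le_spectral_norm[of w "A ** transpose A"]
  by (simp add: inner_mult_eq_transpose power2_norm_eq_inner flip: matrix_vector_mul_assoc)

lemma norm_K_B_le_spectral_norm:
  "(1/2) * (norm (K *v x))\<^sup>2 + (norm (B *v x))\<^sup>2
    \<le> spectral_norm ((1/2) *\<^sub>R (transpose K ** K) + transpose B ** B) * (norm x)\<^sup>2"
  using inner_le_spectral_norm[of x "(1/2) *\<^sub>R (transpose K ** K) + transpose B ** B"]
  by (simp add: matrix_vector_mult_add_rdistrib inner_add_right inner_transpose_mult
      power2_norm_eq_inner flip: scaleR_matrix_vector_assoc matrix_vector_mul_assoc)

lemma energy_coercive:
  fixes A :: "real ^ 'd ^ 'q" and B :: "real ^ 'd ^ 'r" and K :: "real ^ 'd ^ 'p"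
  assumes "spectral_norm (A ** transpose A) < 1"
    and "spectral_norm ((1/2) *\<^sub>R (transpose K ** K) + transpose B ** B) < 1" and "\<alpha> > 0"
  obtains m where "m > 0" "\<And>x w v. m * (norm (x, w, v))\<^sup>2 \<le> energy A B \<alpha> x w v"
proof -
  let ?a = "1 - spectral_norm (A ** transpose A)"
  let ?c = "1 - spectral_norm ((1/2) *\<^sub>R (transpose K ** K) + transpose B ** B)"
  define m where "m = min ?a (min ?c \<alpha>)"
  have "m > 0" using assms by (simp add: m_def)
  moreover have "m * (norm (x, w, v))\<^sup>2 \<le> energy A B \<alpha> x w v" for x w v
  proof -
    have "m * (norm x)\<^sup>2 \<le> ?c * (norm x)\<^sup>2" "m * (norm w)\<^sup>2 \<le> ?a * (norm w)\<^sup>2"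
      "m * (norm v)\<^sup>2 \<le> \<alpha> * (norm v)\<^sup>2"
      by (intro mult_right_mono; simp add: m_def)+
    moreover have "m * (norm (x, w, v))\<^sup>2 = m * (norm x)\<^sup>2 + m * (norm w)\<^sup>2 + m * (norm v)\<^sup>2"
      by (simp add: norm_Pair algebra_simps)
    ultimately show ?thesis
      using norm_transpose_le_spectral_norm[of A w] norm_K_B_le_spectral_norm[of K x B]
        zero_le_power2[of "norm (K *v x)"]
      unfolding energy_def left_diff_distrib by linarith
  qed
  ultimately show thesis using that by blast
qed

text \<open>Pair the \<open>x\<close> update with the new error, use the projection inequality for
  the \<open>w\<close> update and expand the square in the \<open>v\<close> update. The mixed terms
  \<open>(A *v p1) \<bullet> q1\<close> and \<open>(B *v p1) \<bullet> s\<close> cancel, and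
  polarisation turns what remains into energy differences and squared increments.\<close>

lemma energy_descent:
  fixes K :: "real ^ 'd ^ 'p" and A :: "real ^ 'd ^ 'q" and B :: "real ^ 'd ^ 'r"
  assumes l: "l > 0" and \<alpha>: "\<alpha> > 0" and kkt: "kkt K A B y b l x' w' v'"
    and vb: "vb = v - (B *v x - b)"
    and xb: "xb = x + transpose K *v (y - K *v x) + transpose B *v vb - transpose A *v w"
    and w1: "w1 = clip_vec l (w + A *v xb)"
    and x1: "x1 = x + transpose K *v (y - K *v x) + transpose B *v vb - transpose A *v w1"
    and v1: "v1 = v - (1/\<alpha>) *\<^sub>R (B *v x1 - b)"
  shows "energy A B \<alpha> (x1 - x') (w1 - w') (v1 - v')
      + ((norm (x1 - x))\<^sup>2 - (1/2) * (norm (K *v (x1 - x)))\<^sup>2 - (norm (B *v (x1 - x)))\<^sup>2)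
      + ((norm (w1 - w))\<^sup>2 - (norm (transpose A *v (w1 - w)))\<^sup>2)
      + (2 - 1/\<alpha>) * (norm (B *v x1 - b))\<^sup>2
    \<le> energy A B \<alpha> (x - x') (w - w') (v - v')"
proof -
  define p p1 q q1 s s1 where defs: "p = x - x'" "p1 = x1 - x'" "q = w - w'" "q1 = w1 - w'"
    "s = v - v'" "s1 = v1 - v'"
  have Bx': "B *v x' = b"
    and stat: "transpose K *v (K *v x' - y) + transpose A *v w' - transpose B *v v' = 0"
    and w': "\<And>i. \<bar>w' $ i\<bar> \<le> l" "w' = clip_vec l (w' + A *v x')"
    using kkt l unfolding kkt_def by (auto simp: clip_vec_fixed_iff[OF l])
  have w1_le: "\<bar>w1 $ i\<bar> \<le> l" for i
    using l by (simp add: w1 clip_vec_def clip_eq_max_min)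
  note lin = matrix_vector_right_distrib matrix_vector_mult_diff_distrib
    matrix_vector_mult_scaleR
  have Bp1: "B *v x1 - b = B *v p1" by (simp add: defs lin Bx')
  have vb': "vb = v - B *v p" by (simp add: defs lin Bx' vb)
  \<comment> \<open>Subtracting stationarity at the KKT triple leaves an equation in the errors
    only.\<close>
  have "p1 - p = transpose K *v (y - K *v x) + transpose B *v vb - transpose A *v w1"
    by (simp add: defs x1)
  also have "\<dots> = transpose B *v (s - B *v p) - transpose K *v (K *v p) - transpose A *v q1"
    using stat by (simp add: vb' defs lin algebra_simps)
  finally have dp: "p1 - p = transpose B *v (s - B *v p) - transpose K *v (K *v p) - transpose A *v q1" .
  have ix: "p1 \<bullet> (p1 - p) = (B *v p1) \<bullet> s - (B *v p1) \<bullet> (B *v p)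
      - (K *v p1) \<bullet> (K *v p) - (A *v p1) \<bullet> q1"
    unfolding dp by (simp add: inner_diff_right inner_transpose_mult)
  \<comment> \<open>The predictor differs from the new iterate only through the dual increment; this
    produces the \<open>A\<^sup>T\<close> terms of the energy.\<close>
  have xb': "xb = x1 + transpose A *v (w1 - w)"
    by (simp add: xb x1 lin)
  \<comment> \<open>The new dual iterate is tested against \<open>w'\<close> and, conversely,
    \<open>w'\<close> against \<open>w1\<close>; the sum expresses monotonicity of the normal cone
    of the box.\<close>
  have "0 \<le> (w1 - w') \<bullet> (w + A *v xb - w1)"
    unfolding w1 by (intro clip_vec_projection l w')
  moreover have "0 \<le> (w' - w1) \<bullet> (A *v x')"
    using clip_vec_projection[OF l w1_le, of "w' + A *v x'"] by (simp flip: w'(2))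
  moreover have "q1 \<bullet> (w + A *v xb - w1) - q1 \<bullet> (A *v x')
      = (A *v p1) \<bullet> q1 + (transpose A *v q1) \<bullet> (transpose A *v (q1 - q)) - q1 \<bullet> (q1 - q)"
  proof -
    have "q1 \<bullet> (w + A *v xb - w1) - q1 \<bullet> (A *v x')
        = q1 \<bullet> (A *v p1) + q1 \<bullet> (A *v (transpose A *v (q1 - q))) - q1 \<bullet> (q1 - q)"
      by (simp add: xb' defs lin inner_diff_right inner_add_right)
    then show ?thesis
      by (simp add: inner_mult_eq_transpose[of q1 A "transpose A *v (q1 - q)"] inner_commute)
  qed
  ultimately have iw: "q1 \<bullet> (q1 - q) - (transpose A *v q1) \<bullet> (transpose A *v (q1 - q))
      \<le> (A *v p1) \<bullet> q1"
    by (simp add: defs inner_diff_left)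
  have s1: "s1 = s - (1/\<alpha>) *\<^sub>R (B *v p1)" by (simp add: defs v1 Bp1)
  have es: "\<alpha> * (norm s1)\<^sup>2 = \<alpha> * (norm s)\<^sup>2 - 2 * ((B *v p1) \<bullet> s) + (1/\<alpha>) * (norm (B *v p1))\<^sup>2"
    unfolding s1 power2_norm_eq_inner using \<alpha>
    by (simp add: inner_diff_left inner_diff_right inner_commute field_simps)
  have polar: "2 * (a1 \<bullet> (a1 - a)) = a1 \<bullet> a1 - a \<bullet> a + (a1 - a) \<bullet> (a1 - a)"
    for a1 a :: "real ^ 'n"
    by (simp add: inner_diff_left inner_diff_right inner_commute)
  have dx: "x1 - x = p1 - p" and dw: "w1 - w = q1 - q" by (simp_all add: defs)
  \<comment> \<open>Source of the factor 1/2 in front of \<open>K\<^sup>T K\<close>: the difference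
    of the two sides is half the squared norm of \<open>K *v p1 + K *v p\<close>.\<close>
  have K: "- (2 * ((K *v p1) \<bullet> (K *v p))) \<le> (1/2) * (norm (K *v (p1 - p)))\<^sup>2"
    using inner_ge_zero[of "K *v p1 + K *v p"]
    by (simp add: power2_norm_eq_inner lin inner_add_left inner_add_right inner_diff_left
        inner_diff_right inner_commute)
  \<comment> \<open>After forming the energies this leaves
    \<open>- 2 * (norm (B *v p1))\<^sup>2\<close>, which combines with the \<open>1/\<alpha>\<close>
    term of \<open>es\<close> to the coefficient \<open>2 - 1/\<alpha>\<close>.\<close>
  have B: "- (2 * ((B *v p1) \<bullet> (B *v p)))
      = (norm (B *v (p1 - p)))\<^sup>2 - (norm (B *v p1))\<^sup>2 - (norm (B *v p))\<^sup>2"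
    by (simp add: power2_norm_eq_inner lin inner_diff_left inner_diff_right inner_commute)
  have X: "(norm p1)\<^sup>2 - (norm p)\<^sup>2 + (norm (p1 - p))\<^sup>2 = 2 * (p1 \<bullet> (p1 - p))"
    and Q: "(norm q1)\<^sup>2 - (norm q)\<^sup>2 + (norm (q1 - q))\<^sup>2 = 2 * (q1 \<bullet> (q1 - q))"
    and AQ: "(norm (transpose A *v q1))\<^sup>2 - (norm (transpose A *v q))\<^sup>2
        + (norm (transpose A *v (q1 - q)))\<^sup>2
      = 2 * ((transpose A *v q1) \<bullet> (transpose A *v (q1 - q)))"
    by (simp_all add: power2_norm_eq_inner polar lin)
  have "energy A B \<alpha> p1 q1 s1
      + ((norm (p1 - p))\<^sup>2 - (1/2) * (norm (K *v (p1 - p)))\<^sup>2 - (norm (B *v (p1 - p)))\<^sup>2)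
      + ((norm (q1 - q))\<^sup>2 - (norm (transpose A *v (q1 - q)))\<^sup>2)
      + (2 - 1/\<alpha>) * (norm (B *v p1))\<^sup>2
    \<le> energy A B \<alpha> p q s"
    unfolding energy_def es left_diff_distrib
    using ix iw K B X Q AQ by linarith
  then show ?thesis by (simp add: Bp1 dx dw flip: defs)
qed

section \<open>Convergence of the iterates\<close>

theorem theorem2:
  fixes K :: "real ^ 'd ^ 'p" and A :: "real ^ 'd ^ 'q" and B :: "real ^ 'd ^ 'r"
    and y :: "real ^ 'p" and b :: "real ^ 'r"
    and l \<alpha> :: real
    and x xbar :: "nat \<Rightarrow> real ^ 'd" and w :: "nat \<Rightarrow> real ^ 'q"
    and v vbar :: "nat \<Rightarrow> real ^ 'r"
  assumes "l > 0"
    and "{z. B *v z = b} \<noteq> {}"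
    and "spectral_norm (A ** transpose A) < 1"
    and "spectral_norm ((1/2) *\<^sub>R (transpose K ** K) + transpose B ** B) < 1"
    and "\<alpha> > 1/2"
    and "\<And>n. vbar (Suc n) = v n - (B *v x n - b)"
    and "\<And>n. xbar (Suc n) = x n + transpose K *v (y - K *v x n)
           + transpose B *v vbar (Suc n) - transpose A *v w n"
    and "\<And>n. w (Suc n) = clip_vec l (w n + A *v xbar (Suc n))"
    and "\<And>n. x (Suc n) = x n + transpose K *v (y - K *v x n)
           + transpose B *v vbar (Suc n) - transpose A *v w (Suc n)"
    and "\<And>n. v (Suc n) = v n - (1/\<alpha>) *\<^sub>R (B *v x (Suc n) - b)"
  shows "\<exists>x' w' v'.
      (\<lambda>n. (x n, w n, v n)) \<longlonglongrightarrow> (x', w', v') \<and>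
      transpose K *v (K *v x' - y) + transpose A *v w' - transpose B *v v' = 0 \<and>
      w' = clip_vec l (w' + A *v x') \<and>
      B *v x' = b \<and>
      is_arg_min (\<lambda>z. (norm (K *v z - y))\<^sup>2 + 2 * l * l1_norm (A *v z)) (\<lambda>z. B *v z = b) x'"
proof -
  note l = assms(1) and it = assms(6-10)
  have \<alpha>: "\<alpha> > 0" using assms(5) by simp
  define cA where "cA = 1 - spectral_norm (A ** transpose A)"
  define cK where "cK = 1 - spectral_norm ((1/2) *\<^sub>R (transpose K ** K) + transpose B ** B)"
  define D where "D n = cK * (norm (x (Suc n) - x n))\<^sup>2 + cA * (norm (w (Suc n) - w n))\<^sup>2
    + (2 - 1/\<alpha>) * (norm (B *v x (Suc n) - b))\<^sup>2" for n
  have c: "cA > 0" "cK > 0" "2 - 1/\<alpha> > 0"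
    using assms(3-5) \<alpha> by (simp_all add: cA_def cK_def field_simps)
  have D_nonneg: "D n \<ge> 0" for n
    using c by (simp add: D_def)
  obtain m where m: "m > 0" "\<And>x w v. m * (norm (x, w, v))\<^sup>2 \<le> energy A B \<alpha> x w v"
    using energy_coercive[OF assms(3,4) \<alpha>] by blast
  \<comment> \<open>The spectral norm bounds turn the increments of \<open>energy_descent\<close>
    into positive multiples of squared norms.\<close>
  have descent: "energy A B \<alpha> (x (Suc n) - x') (w (Suc n) - w') (v (Suc n) - v') + D n
      \<le> energy A B \<alpha> (x n - x') (w n - w') (v n - v')"
    if "kkt K A B y b l x' w' v'" for x' w' v' n
    using energy_descent[OF l \<alpha> that it(1)[of n] it(2)[of n] it(3)[of n] it(4)[of n] it(5)[of n]]
      norm_transpose_le_spectral_norm[of A "w (Suc n) - w n"]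
      norm_K_B_le_spectral_norm[of K "x (Suc n) - x n" B]
    unfolding D_def cA_def cK_def left_diff_distrib[of 1] by linarith
  obtain x0 w0 v0 where k0: "kkt K A B y b l x0 w0 v0"
    using kkt_exists[OF l] assms(2) by blast
  define E where "E n = energy A B \<alpha> (x n - x0) (w n - w0) (v n - v0)" for n
  have E_step: "E (Suc n) + D n \<le> E n" for n
    unfolding E_def by (rule descent[OF k0])
  have E_nonneg: "0 \<le> E n" for n
    unfolding E_def using m(1) by (intro order_trans[OF _ m(2)]) simp
  \<comment> \<open>Telescoping: the drops are summable, hence tend to zero.\<close>
  have E_sum: "E n + (\<Sum>i<n. D i) \<le> E 0" for n
  proof (induction n)
    case (Suc n)
    then show ?case using E_step[of n] by simp
  qed simp
  then have "(\<Sum>i\<le>n. D i) \<le> E 0" for n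
    using E_nonneg[of "Suc n"] unfolding lessThan_Suc_atMost[symmetric] by (smt (verit))
  then have "D \<longlonglongrightarrow> 0"
    using D_nonneg by (intro summable_LIMSEQ_zero bounded_imp_summable)
  have to_zero: "f \<longlonglongrightarrow> 0"
    if "k > 0" "\<And>n. k * (norm (f n))\<^sup>2 \<le> D n" for k and f :: "nat \<Rightarrow> real ^ 'n"
  proof -
    have "(\<lambda>n. (norm (f n))\<^sup>2) \<longlonglongrightarrow> 0"
    proof (rule tendsto_sandwich[OF _ _ tendsto_const])
      show "(\<lambda>n. D n / k) \<longlonglongrightarrow> 0" using \<open>D \<longlonglongrightarrow> 0\<close> by (rule tendsto_divide_zero)
      show "\<forall>\<^sub>F n in sequentially. (norm (f n))\<^sup>2 \<le> D n / k"
        using that by (auto simp: field_simps)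
    qed simp
    then show ?thesis
      by (simp add: tendsto_norm_zero_iff)
  qed
  have dx: "(\<lambda>n. x (Suc n) - x n) \<longlonglongrightarrow> 0"
    by (rule to_zero[OF c(2)]) (use c in \<open>simp add: D_def\<close>)
  have dw: "(\<lambda>n. w (Suc n) - w n) \<longlonglongrightarrow> 0"
    by (rule to_zero[OF c(1)]) (use c in \<open>simp add: D_def\<close>)
  have res: "(\<lambda>n. B *v x (Suc n) - b) \<longlonglongrightarrow> 0"
    by (rule to_zero[OF c(3)]) (use c in \<open>simp add: D_def\<close>)
  let ?p = "\<lambda>n. (x n, w n, v n)"
  have "norm (?p n) \<le> sqrt (E 0 / m) + norm (x0, w0, v0)" for n
  proof -
    have "m * (norm (?p n - (x0, w0, v0)))\<^sup>2 \<le> E n"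
      unfolding E_def diff_Pair by (rule m(2))
    also have "\<dots> \<le> E 0"
      using E_sum[of n] sum_nonneg[of "{..<n}" D] D_nonneg by (smt (verit))
    finally have "(norm (?p n - (x0, w0, v0)))\<^sup>2 \<le> E 0 / m"
      using m(1) by (simp add: field_simps)
    then have "norm (?p n - (x0, w0, v0)) \<le> sqrt (E 0 / m)" by (rule real_le_rsqrt)
    then show ?thesis using norm_triangle_sub[of "?p n" "(x0, w0, v0)"] by linarith
  qed
  then have "bounded (range ?p)" by (auto simp: bounded_iff)
  then obtain P \<sigma> where \<sigma>: "strict_mono \<sigma>" and "(?p \<circ> \<sigma>) \<longlonglongrightarrow> P"
    using bounded_imp_convergent_subsequence by blast
  moreover obtain x' w' v' where "P = (x', w', v')" by (cases P)
  ultimately have lim: "(\<lambda>n. ?p (\<sigma> n)) \<longlonglongrightarrow> (x', w', v')" by (simp add: o_def)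
  have xl: "(\<lambda>n. x (\<sigma> n)) \<longlonglongrightarrow> x'" and wl: "(\<lambda>n. w (\<sigma> n)) \<longlonglongrightarrow> w'"
    and vl: "(\<lambda>n. v (\<sigma> n)) \<longlonglongrightarrow> v'"
    using tendsto_fst[OF lim] tendsto_fst[OF tendsto_snd[OF lim]]
      tendsto_snd[OF tendsto_snd[OF lim]] by simp_all
  have sub: "(\<lambda>n. f (\<sigma> n)) \<longlonglongrightarrow> 0" if "f \<longlonglongrightarrow> 0" for f :: "nat \<Rightarrow> real ^ 'n"
    using LIMSEQ_subseq_LIMSEQ[OF that \<sigma>] by (simp add: o_def)
  \<comment> \<open>Vanishing increments give the shifted subsequences the same limits, so both
    sides of each update can be passed to the limit.\<close>
  have xl1: "(\<lambda>n. x (Suc (\<sigma> n))) \<longlonglongrightarrow> x'"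
    using tendsto_add[OF xl sub[OF dx]] by simp
  have wl1: "(\<lambda>n. w (Suc (\<sigma> n))) \<longlonglongrightarrow> w'"
    using tendsto_add[OF wl sub[OF dw]] by simp
  have Bx': "B *v x' = b"
  proof -
    have "(\<lambda>n. B *v x (Suc (\<sigma> n)) - b) \<longlonglongrightarrow> B *v x' - b"
      by (intro tendsto_intros xl1)
    from LIMSEQ_unique[OF this sub[OF res]] show ?thesis by simp
  qed
  have vbl: "(\<lambda>n. vbar (Suc (\<sigma> n))) \<longlonglongrightarrow> v'"
  proof -
    have "(\<lambda>n. vbar (Suc (\<sigma> n))) \<longlonglongrightarrow> v' - (B *v x' - b)"
      unfolding it(1) by (intro tendsto_intros xl vl)
    then show ?thesis by (simp add: Bx')
  qed
  \<comment> \<open>Both the \<open>x\<close> and the \<open>xbar\<close> update tend to this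
    vector: the former identifies it with \<open>x'\<close>, which is stationarity, and the latter
    then supplies the argument of the clipping.\<close>
  let ?x = "x' + transpose K *v (y - K *v x') + transpose B *v v' - transpose A *v w'"
  have "(\<lambda>n. x (Suc (\<sigma> n))) \<longlonglongrightarrow> ?x"
    unfolding it(4) by (intro tendsto_intros xl vbl wl1)
  then have stat: "?x = x'" using xl1 by (rule LIMSEQ_unique)
  have "(\<lambda>n. xbar (Suc (\<sigma> n))) \<longlonglongrightarrow> ?x"
    unfolding it(2) by (intro tendsto_intros xl vbl wl)
  then have "(\<lambda>n. w (Suc (\<sigma> n))) \<longlonglongrightarrow> clip_vec l (w' + A *v x')"
    unfolding it(3) stat by (intro tendsto_clip_vec l tendsto_intros wl)
  then have w': "w' = clip_vec l (w' + A *v x')" by (rule LIMSEQ_unique[OF wl1])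
  have "transpose K *v (K *v x' - y) + transpose A *v w' - transpose B *v v' = 0"
    using stat by (simp add: matrix_vector_mult_diff_distrib algebra_simps)
  with w' Bx' have kkt: "kkt K A B y b l x' w' v'" unfolding kkt_def by blast

  \<comment> \<open>Opial-type argument: \<open>G\<close> decreases, so its limit equals the limit 0
    along the subsequence, and coercivity transfers this to the whole sequence.\<close>
  define G where "G n = energy A B \<alpha> (x n - x') (w n - w') (v n - v')" for n
  have "decseq G"
    unfolding G_def by (intro decseq_SucI) (use descent[OF kkt] D_nonneg in \<open>smt (verit)\<close>)
  have G_nonneg: "0 \<le> G n" for n
    unfolding G_def using m(1) by (intro order_trans[OF _ m(2)]) simp
  obtain g where g: "G \<longlonglongrightarrow> g"
    using decseq_convergent[OF \<open>decseq G\<close>, of 0] G_nonneg by blast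
  have "(\<lambda>n. G (\<sigma> n)) \<longlonglongrightarrow> energy A B \<alpha> (x' - x') (w' - w') (v' - v')"
    unfolding G_def energy_def by (intro tendsto_intros xl wl vl)
  then have "(\<lambda>n. G (\<sigma> n)) \<longlonglongrightarrow> 0" by (simp add: energy_def)
  with LIMSEQ_subseq_LIMSEQ[OF g \<sigma>] have "g = 0"
    by (auto simp: o_def dest: LIMSEQ_unique)
  have "(\<lambda>n. (norm (?p n - (x', w', v')))\<^sup>2) \<longlonglongrightarrow> 0"
  proof (rule tendsto_sandwich[OF _ _ tendsto_const])
    show "(\<lambda>n. G n / m) \<longlonglongrightarrow> 0"
      using g \<open>g = 0\<close> by (intro tendsto_divide_zero) simp
    have "(norm (?p n - (x', w', v')))\<^sup>2 \<le> G n / m" for n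
      using m(1) m(2)[of "x n - x'" "w n - w'" "v n - v'"] by (simp add: G_def field_simps)
    then show "\<forall>\<^sub>F n in sequentially. (norm (?p n - (x', w', v')))\<^sup>2 \<le> G n / m" by simp
  qed simp
  then have "?p \<longlonglongrightarrow> (x', w', v')"
    by (simp add: tendsto_norm_zero_iff LIM_zero_iff del: diff_Pair)
  then show ?thesis
    using kkt kkt_imp_arg_min[OF l kkt] unfolding kkt_def by blast
qed

end
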